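(* Let $s,t,q$ be positive integers. (i) If $2\le q\le \frac{t+1}{2}$, then for every positive integer $n$, $$\left\lceil \frac{n}{(t-1)/(q-1)}\right\rceil \le r(K_{n,n},K_{1,t},q)\le \left\lceil \frac{n}{\lfloor (t-1)/(q-1)\rfloor}\right\rceil .$$ (ii) If $\frac{t+2}{2}\le q\le t$, then for every integer $n\ge t$, $r(K_{n,n},K_{1,t},q)=n-t+q$. (iii) If $t\ge s\ge 2$ and $q=st-s-t+3$, then $r(K_{n,n},K_{s,t},q)=\Theta(n)$ and $r(K_{n,n},K_{s,t},q-1)=O\!\left(n^{1-\frac{1}{s+t-1}}\right)$.
   Context: For graphs $G,H$ and an integer $q$ with $2\le q\le |E(H)|$, an $(H,q)$-coloring of $G$ is an edge-coloring of $G$ (not necessarily proper) in which every subgraph of $G$ isomorphic to $H$ receives at least $q$ distinct colors. $r(G,H,q)$ denotes the minimum number of colors needed for $G$ to have an $(H,q)$-coloring. $K_{n,n}$ is the complete bipartite graph with both parts of size $n$, and $K_{s,t}$ the complete bipartite graph with parts of sizes $s$ and $t$. Asymptotic notation $O,\Theta$ refers to $n\to\infty$ with $s,t,q$ fixed.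
   Formalization: In (i) the lower bound is claimed only for n ≥ t or n ≤ (t-1)/(q-1); for (t-1)/(q-1) < n < t it is false, since K_{n,n} contains no K_{1,t} and r = 1 (e.g. n=4, t=5, q=3: r = 1 but the bound is 2). *)

theory Defs
  imports Complex_Main "HOL-Library.Landau_Symbols" "HOL-Library.Ramsey"
begin

datatype 'a graph = Graph (verts: "'a set") (edges: "'a set set")

definition simple_graph :: "'a graph \<Rightarrow> bool" where
  "simple_graph G \<longleftrightarrow> finite (verts G) \<and> edges G \<subseteq> nsets (verts G) 2"

definition subgraph :: "'a graph \<Rightarrow> 'a graph \<Rightarrow> bool" where
  "subgraph F G \<longleftrightarrow> simple_graph F \<and> verts F \<subseteq> verts G \<and> edges F \<subseteq> edges G"

definition graph_iso :: "'a graph \<Rightarrow> 'b graph \<Rightarrow> bool" where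
  "graph_iso F H \<longleftrightarrow> (\<exists>f. bij_betw f (verts F) (verts H) \<and> (\<lambda>e. f ` e) ` edges F = edges H)"

definition Hq_coloring :: "'a graph \<Rightarrow> 'b graph \<Rightarrow> nat \<Rightarrow> ('a set \<Rightarrow> 'c) \<Rightarrow> bool" where
  "Hq_coloring G H q c \<longleftrightarrow>
     (\<forall>F. subgraph F G \<and> graph_iso F H \<longrightarrow> q \<le> card (c ` edges F))"

text \<open>
  For finite \<open>G\<close> and \<open>q \<le> card (edges H)\<close> the set of admissible numbers of colors is nonempty
  (lemma \<open>ex_Hq_coloring\<close> below), so the \<open>LEAST\<close> is attained. Outside that range the value may be
  unspecified.
\<close>

definition ramsey_r :: "'a graph \<Rightarrow> 'b graph \<Rightarrow> nat \<Rightarrow> nat" where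
  "ramsey_r G H q =
     (LEAST k. \<exists>c :: 'a set \<Rightarrow> nat. Hq_coloring G H q c \<and> card (c ` edges G) = k)"

definition complete_bipartite :: "nat \<Rightarrow> nat \<Rightarrow> (nat + nat) graph" where
  "complete_bipartite m n =
     Graph ({..<m} <+> {..<n}) {{Inl i, Inr j} | i j. i < m \<and> j < n}"

lemma simple_graph_complete_bipartite: "simple_graph (complete_bipartite m n)"
  by (auto simp: simple_graph_def complete_bipartite_def nsets_def)

lemma card_edges_complete_bipartite: "card (edges (complete_bipartite m n)) = m * n"
proof -
  let ?e = "\<lambda>(i, j). {Inl i, Inr j} :: (nat + nat) set"
  have "edges (complete_bipartite m n) = ?e ` ({..<m} \<times> {..<n})"
  proof (rule set_eqI)
    fix x
    show "x \<in> edges (complete_bipartite m n) \<longleftrightarrow> x \<in> ?e ` ({..<m} \<times> {..<n})"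
      by (simp add: complete_bipartite_def image_iff Bex_def conj_ac)
  qed
  moreover have "inj_on ?e ({..<m} \<times> {..<n})"
    by (auto simp: inj_on_def doubleton_eq_iff)
  ultimately show ?thesis
    by (simp add: card_image)
qed

lemma ex_Hq_coloring:
  fixes G :: "'a graph" and H :: "'b graph"
  assumes "simple_graph G" and "q \<le> card (edges H)"
  shows "\<exists>c :: 'a set \<Rightarrow> nat. Hq_coloring G H q c"
proof -
  have "finite (edges G)"
    using assms(1) finite_imp_finite_nsets finite_subset unfolding simple_graph_def by blast
  then obtain c :: "'a set \<Rightarrow> nat" where c: "inj_on c (edges G)"
    using finite_imp_inj_to_nat_seg[of "edges G"] by blast
  have "q \<le> card (c ` edges F)" if F: "subgraph F G" "graph_iso F H" for F
  proof -
    obtain f where f: "bij_betw f (verts F) (verts H)" "(\<lambda>e. f ` e) ` edges F = edges H"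
      using F(2) unfolding graph_iso_def by blast
    have "edges F \<subseteq> Pow (verts F)"
      using F(1) unfolding subgraph_def simple_graph_def nsets_def by blast
    then have "inj_on (\<lambda>e. f ` e) (edges F)"
      by (rule inj_on_subset[OF inj_on_image_Pow[OF bij_betw_imp_inj_on[OF f(1)]]])
    from card_image[OF this] have "card (edges F) = card (edges H)"
      unfolding f(2) by (rule sym)
    moreover have "inj_on c (edges F)"
      using F(1) unfolding subgraph_def by (blast intro: inj_on_subset[OF c])
    ultimately show ?thesis
      using assms(2) by (simp add: card_image)
  qed
  then show ?thesis
    unfolding Hq_coloring_def by blast
qed

end

theory Submission
  imports Defs "HOL-Library.FuncSet"
begin

text \<open>
  For stars everything is local: restricting a coloring to one vertex gives a function on \<open>n\<close> leaves,
  and conversely a function on \<open>{..<n}\<close> composed with a cyclic Latin square gives a coloring that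
  looks the same at every vertex. The lower bounds are then averaging over the \<open>q - 1\<close> largest color
  classes, or, when \<open>2 q \<ge> t + 2\<close>, collecting \<open>t\<close> edges by adding \<open>t - q + 1\<close> repeated ones to
  representatives of \<open>q - 1\<close> colors.

  For \<open>K\<^sub>s\<^sub>,\<^sub>t\<close>, fewer than \<open>n / (2 t)\<close> colors force a monochromatic double star spanning a copy,
  which saves \<open>s + t - 2\<close> colors. Both upper bounds come from one local-lemma type statement: if
  \<open>k\<^sup>d \<ge> C n\<^sup>s\<^sup>+\<^sup>t\<^sup>-\<^sup>2\<close>, some \<open>k\<close>-coloring gives every copy more than \<open>s t - d\<close> colors; take
  \<open>d = s + t - 2\<close> and \<open>d = s + t - 1\<close>.
\<close>

section \<open>Counting colorings in the style of the local lemma\<close>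

lemma card_UN_le_mult:
  assumes "finite I" "card I \<le> a" "\<And>i. i \<in> I \<Longrightarrow> real (card (A i)) \<le> b" "0 \<le> b"
  shows "real (card (\<Union>i\<in>I. A i)) \<le> real a * b"
proof -
  have "real (card (\<Union>i\<in>I. A i)) \<le> (\<Sum>i\<in>I. real (card (A i)))"
    using card_UN_le[OF assms(1), of A] of_nat_mono[where 'a = real] by fastforce
  also have "\<dots> \<le> real (card I) * b"
    using assms(3) by (rule sum_bounded_above)
  also have "\<dots> \<le> real a * b"
    using assms(2,4) by (simp add: mult_right_mono)
  finally show ?thesis .
qed

text \<open>The inequality says that \<open>H\<close> sees more than \<open>card H - d\<close>
  colors, without truncated subtraction. Only members of \<open>F\<close> inside \<open>S\<close>
  are constrained, so the condition can be followed as \<open>S\<close> grows. Extensional functions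
  make the colorings of a finite \<open>S\<close> a finite set to count.\<close>

definition good_colorings :: "'e set set \<Rightarrow> nat \<Rightarrow> nat \<Rightarrow> 'e set \<Rightarrow> ('e \<Rightarrow> nat) set" where
  "good_colorings F k d S =
     {c \<in> S \<rightarrow>\<^sub>E {..<k}. \<forall>H\<in>F. H \<subseteq> S \<longrightarrow> card H < card (c ` H) + d}"

lemma finite_good_colorings: "finite S \<Longrightarrow> finite (good_colorings F k d S)"
  unfolding good_colorings_def by (simp add: finite_PiE)

lemma restrict_good_colorings:
  assumes "c \<in> good_colorings F k d S" "T \<subseteq> S"
  shows "restrict c T \<in> good_colorings F k d T"
proof -
  have "restrict c T ` H = c ` H" if "H \<subseteq> T" for H
    using that by auto
  then show ?thesis
    using assms unfolding good_colorings_def by (auto simp: PiE_iff subset_iff)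
qed

text \<open>Choose one representative of each color on \<open>H\<close>, taking \<open>e\<close> for
  its own color. At least \<open>d\<close> other elements remain; \<open>B\<close> consists of
  \<open>d\<close> of them and \<open>g\<close> sends each to the representative of its color.
  Keeping \<open>e\<close> outside \<open>B\<close> lets the color of \<open>e\<close> be counted
  separately.\<close>

lemma few_colors_witness:
  assumes "finite H" "e \<in> H" "card (c ` H) + d \<le> card H"
  obtains B g where "B \<subseteq> H - {e}" "card B = d" "g \<in> B \<rightarrow>\<^sub>E H - B" "\<And>b. b \<in> B \<Longrightarrow> c b = c (g b)"
proof -
  define r where "r x = (if x = c e then e else inv_into H c x)" for x
  define R where "R = r ` c ` H"
  have r: "r (c h) \<in> H" "c (r (c h)) = c h" if "h \<in> H" for h
    using that assms(2) by (auto simp: r_def inv_into_into f_inv_into_f)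
  have "e \<in> R" "R \<subseteq> H"
    using assms(2) r(1) by (auto simp: R_def) (auto simp: r_def image_iff)
  have "card R \<le> card (c ` H)"
    unfolding R_def using assms(1) by (simp add: card_image_le)
  then have "d \<le> card (H - R)"
    using assms(1,3) \<open>R \<subseteq> H\<close> by (simp add: card_Diff_subset finite_subset)
  then obtain B where B: "B \<subseteq> H - R" "card B = d"
    by (meson obtain_subset_with_card_n)
  show thesis
  proof (rule that[of B "restrict (r \<circ> c) B"])
    show "B \<subseteq> H - {e}" using B \<open>e \<in> R\<close> by auto
    have "r (c b) \<in> H - B" if "b \<in> B" for b
    proof -
      have "b \<in> H" using that B by auto
      then show ?thesis using B r(1) by (auto simp: R_def)
    qed
    then show "restrict (r \<circ> c) B \<in> B \<rightarrow>\<^sub>E H - B" by auto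
    show "c b = c (restrict (r \<circ> c) B b)" if "b \<in> B" for b
      using that B r(2)[of b] by auto
  qed (use B in auto)
qed

text \<open>
  If \<open>H\<close> sees too few colors, the colors on some \<open>B \<subseteq> H - {e}\<close> with \<open>d\<close> elements are copied
  from the rest of \<open>H\<close>, so the coloring is determined by its values on \<open>S - B\<close>.
\<close>

lemma good_colorings_step:
  fixes F :: "'e set set"
  assumes F: "finite F" "\<And>H. H \<in> F \<Longrightarrow> finite H \<and> card H = m"
    and deg: "card {H \<in> F. e \<in> H} \<le> D"
    and k: "2 ^ (d + 1) * 2 ^ m * m ^ d * D \<le> k ^ d" "0 < k"
    and S: "finite S" "e \<in> S"
    and IH: "\<And>B. B \<subseteq> S - {e} \<Longrightarrow> card B = d \<Longrightarrow>
      (real k / 2) ^ d * real (card (good_colorings F k d (S - {e} - B)))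
        \<le> real (card (good_colorings F k d (S - {e})))"
  shows "real k / 2 * real (card (good_colorings F k d (S - {e})))
           \<le> real (card (good_colorings F k d S))"
proof -
  let ?N = "\<lambda>S. real (card (good_colorings F k d S))"
  define T where "T = S - {e}"
  \<comment> \<open>\<open>X\<close> allows any color at \<open>e\<close>; what is lost on passing
    to good colorings of \<open>S\<close> falls into the sets \<open>Y B g\<close>. The bound
    \<open>M\<close> for each of these is \<open>k\<close> choices at \<open>e\<close> times the
    number of good colorings of \<open>T - B\<close>, which \<open>IH\<close> compares with that of
    \<open>T\<close>.\<close>
  define X where "X = {c \<in> S \<rightarrow>\<^sub>E {..<k}. restrict c T \<in> good_colorings F k d T}"
  define Y where "Y B g = {c \<in> X. \<forall>b\<in>B. c b = c (g b)}" for B :: "'e set" and g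
  define M where "M = real k * ((2 / real k) ^ d * ?N T)"
  define Hs where "Hs = {H \<in> F. e \<in> H \<and> H \<subseteq> S}"
  define Bs where "Bs H = {B. B \<subseteq> H - {e} \<and> card B = d}" for H
  have M0: "0 \<le> M" by (simp add: M_def)
  have eT: "e \<notin> T" "insert e T = S" using S by (auto simp: T_def)
  have finX: "finite X"
    unfolding X_def using S by (simp add: finite_PiE)
  have "card (good_colorings F k d T \<times> {..<k}) \<le> card X"
  proof (rule card_inj_on_le[where f = "\<lambda>(c, x). c(e := x)"])
    show "inj_on (\<lambda>(c, x). c(e := x)) (good_colorings F k d T \<times> {..<k})"
    proof (rule inj_onI, clarify)
      fix c x c' x'
      assume c: "c \<in> good_colorings F k d T" "c' \<in> good_colorings F k d T"
        and eq: "c(e := x) = c'(e := x')"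
      have "c v = c' v" for v
      proof (cases "v = e")
        case True
        then show ?thesis using c eT by (auto simp: good_colorings_def PiE_def extensional_def)
      next
        case False
        then show ?thesis using fun_cong[OF eq, of v] by simp
      qed
      moreover have "x = x'" using fun_cong[OF eq, of e] by simp
      ultimately show "c = c' \<and> x = x'" by auto
    qed
    have "c(e := x) \<in> X" if c: "c \<in> good_colorings F k d T" and "x < k" for c x
    proof -
      have cT: "c \<in> T \<rightarrow>\<^sub>E {..<k}" using c by (simp add: good_colorings_def)
      have "restrict (c(e := x)) T = c"
        using cT eT by (intro ext) (auto simp: restrict_def PiE_def extensional_def)
      moreover have "c(e := x) \<in> S \<rightarrow>\<^sub>E {..<k}"
        using cT \<open>x < k\<close> eT(2)[symmetric] by (auto simp: PiE_iff extensional_def)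
      ultimately show ?thesis using c by (simp add: X_def)
    qed
    then show "(\<lambda>(c, x). c(e := x)) ` (good_colorings F k d T \<times> {..<k}) \<subseteq> X" by auto
  qed (fact finX)
  then have lower: "real k * ?N T \<le> real (card X)"
    by (simp add: card_cartesian_product mult.commute flip: of_nat_mult)

  have cardY: "real (card (Y B g)) \<le> M"
    if H: "H \<in> Hs" and B: "B \<in> Bs H" and g: "g \<in> B \<rightarrow>\<^sub>E H - B" for H B g
  proof -
    have BT: "B \<subseteq> T" using H B by (auto simp: Hs_def Bs_def T_def)
    have gB: "g b \<in> S - B" if "b \<in> B" for b
      using PiE_mem[OF g that] H by (auto simp: Hs_def)
    \<comment> \<open>Since \<open>g\<close> takes values outside \<open>B\<close>, the colors on
      \<open>B\<close> can be read off from those on \<open>T - B\<close> and at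
      \<open>e\<close>.\<close>
    have "card (Y B g) \<le> card (good_colorings F k d (T - B) \<times> {..<k})"
    proof (rule card_inj_on_le[where f = "\<lambda>c. (restrict c (T - B), c e)"])
      show "inj_on (\<lambda>c. (restrict c (T - B), c e)) (Y B g)"
      proof (rule inj_onI)
        fix c c' assume c: "c \<in> Y B g" "c' \<in> Y B g"
          and eq: "(restrict c (T - B), c e) = (restrict c' (T - B), c' e)"
        have 1: "c v = c' v" if "v \<in> S - B" for v
        proof (cases "v = e")
          case False
          then have "v \<in> T - B" using that by (simp add: T_def)
          then show ?thesis using eq by (metis prod.inject restrict_apply')
        qed (use eq in simp)
        have 2: "c v = c' v" if "v \<in> B" for v
          using 1[OF gB[OF that]] c that by (simp add: Y_def)
        show "c = c'"
        proof (rule PiE_ext[where x = c and y = c' and k = S and s = "\<lambda>_. {..<k}"])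
          show "c v = c' v" if "v \<in> S" for v
            using that 1 2 by blast
        qed (use c in \<open>auto simp: Y_def X_def\<close>)
      qed
      show "(\<lambda>c. (restrict c (T - B), c e)) ` Y B g \<subseteq> good_colorings F k d (T - B) \<times> {..<k}"
      proof clarify
        fix c assume c: "c \<in> Y B g"
        then have "restrict c T \<in> good_colorings F k d T" by (simp add: Y_def X_def)
        from restrict_good_colorings[OF this, of "T - B"]
        have "restrict (restrict c T) (T - B) \<in> good_colorings F k d (T - B)"
          by simp
        moreover have "restrict (restrict c T) (T - B) = restrict c (T - B)"
          by (auto simp: restrict_def)
        moreover have "c e < k" using c S(2) by (auto simp: Y_def X_def PiE_iff)
        ultimately show "restrict c (T - B) \<in> good_colorings F k d (T - B) \<and> c e \<in> {..<k}"
          by simp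
      qed
      show "finite (good_colorings F k d (T - B) \<times> {..<k})"
        using S by (simp add: T_def finite_good_colorings)
    qed
    then have "real (card (Y B g)) \<le> real k * ?N (T - B)"
      by (simp add: card_cartesian_product mult.commute flip: of_nat_mult)
    also have "?N (T - B) \<le> (2 / real k) ^ d * ?N T"
      using IH[of B] BT B k(2) by (simp add: T_def Bs_def field_simps)
    finally show ?thesis by (simp add: M_def mult_left_mono)
  qed

  have "c \<in> good_colorings F k d S \<union> (\<Union>H\<in>Hs. \<Union>B\<in>Bs H. \<Union>g\<in>(B \<rightarrow>\<^sub>E H - B). Y B g)"
    if c: "c \<in> X" for c
  proof (rule ccontr)
    assume neg: "\<not> ?thesis"
    then obtain H where H: "H \<in> F" "H \<subseteq> S" "card (c ` H) + d \<le> card H"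
      using c unfolding good_colorings_def X_def by auto
    \<comment> \<open>An offending \<open>H\<close> avoiding \<open>e\<close> would already violate
      goodness on \<open>T\<close>.\<close>
    have "e \<in> H"
    proof (rule ccontr)
      assume "e \<notin> H"
      then have HT: "H \<subseteq> T" using H by (auto simp: T_def)
      then have "card H < card (restrict c T ` H) + d"
        using c H(1) by (auto simp: X_def good_colorings_def)
      moreover have "restrict c T ` H = c ` H" using HT by auto
      ultimately show False using H by simp
    qed
    then obtain B g where "B \<subseteq> H - {e}" "card B = d" "g \<in> B \<rightarrow>\<^sub>E H - B"
        "\<And>b. b \<in> B \<Longrightarrow> c b = c (g b)"
      using few_colors_witness[of H e c d] F(2) H by blast
    then have "H \<in> Hs" "B \<in> Bs H" "g \<in> B \<rightarrow>\<^sub>E H - B" "c \<in> Y B g"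
      using H \<open>e \<in> H\<close> c by (auto simp: Hs_def Bs_def Y_def)
    then show False using neg by blast
  qed
  then have sub: "X \<subseteq> good_colorings F k d S \<union>
      (\<Union>H\<in>Hs. \<Union>B\<in>Bs H. \<Union>g\<in>(B \<rightarrow>\<^sub>E H - B). Y B g)" (is "_ \<subseteq> _ \<union> ?U")
    by blast
  have "?U \<subseteq> X" by (auto simp: Y_def)
  then have "finite ?U" using finX by (rule finite_subset)
  then have "card X \<le> card (good_colorings F k d S \<union> ?U)"
    using S finite_good_colorings by (intro card_mono[OF _ sub]) auto
  also have "\<dots> \<le> card (good_colorings F k d S) + card ?U"
    by (rule card_Un_le)
  finally have split: "real (card X) \<le> ?N S + real (card ?U)"
    by (simp flip: of_nat_add)

  \<comment> \<open>Union bound: at most \<open>D\<close> choices of \<open>H\<close>,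
    \<open>2 ^ m\<close> of \<open>B\<close> and \<open>m ^ d\<close> of \<open>g\<close>.\<close>
  have "real (card ?U) \<le> real D * (real (2 ^ m) * (real (m ^ d) * M))"
  proof (rule card_UN_le_mult)
    show "finite Hs" using F by (simp add: Hs_def)
    have "card Hs \<le> card {H \<in> F. e \<in> H}" using F by (intro card_mono) (auto simp: Hs_def)
    then show "card Hs \<le> D" using deg by simp
    fix H assume H: "H \<in> Hs"
    then have finH: "finite H" "card H = m" using F by (auto simp: Hs_def)
    show "real (card (\<Union>B\<in>Bs H. \<Union>g\<in>(B \<rightarrow>\<^sub>E H - B). Y B g)) \<le> real (2 ^ m) * (real (m ^ d) * M)"
    proof (rule card_UN_le_mult)
      have sub: "Bs H \<subseteq> Pow H" by (auto simp: Bs_def)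
      then show "finite (Bs H)" using finH finite_subset by blast
      show "card (Bs H) \<le> 2 ^ m"
        using card_mono[OF _ sub] finH by (simp add: card_Pow)
      fix B assume B: "B \<in> Bs H"
      then have finB: "finite B" "card B = d" using finH by (auto simp: Bs_def intro: finite_subset)
      show "real (card (\<Union>g\<in>(B \<rightarrow>\<^sub>E H - B). Y B g)) \<le> real (m ^ d) * M"
      proof (rule card_UN_le_mult)
        show "finite (B \<rightarrow>\<^sub>E H - B)" using finB finH by (simp add: finite_PiE)
        have "card (H - B) ^ d \<le> m ^ d"
          using finH by (intro power_mono) (auto intro: card_mono)
        then show "card (B \<rightarrow>\<^sub>E H - B) \<le> m ^ d"
          using finB by (simp add: card_PiE)
      qed (use cardY[OF H B] M0 in auto)
    qed (use M0 in auto)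
  qed (use M0 in auto)
  \<comment> \<open>Of \<open>2 ^ (d + 1)\<close>, the power \<open>2 ^ d\<close> comes from
    \<open>M\<close>; the last factor 2 ensures that at most half of the
    \<open>real k * ?N T\<close> guaranteed colorings are lost.\<close>
  also have "\<dots> = real (2 ^ (d + 1) * 2 ^ m * m ^ d * D) / real (k ^ d) * (real k / 2 * ?N T)"
    by (simp add: M_def field_simps)
  also have "\<dots> \<le> 1 * (real k / 2 * ?N T)"
  proof (rule mult_right_mono)
    show "real (2 ^ (d + 1) * 2 ^ m * m ^ d * D) / real (k ^ d) \<le> 1"
      using k by (subst divide_le_eq_1_pos) (simp_all only: of_nat_le_iff, simp)
  qed simp
  finally show ?thesis
    using lower split by (simp add: T_def)
qed

text \<open>
  Rosenfeld's counting form of the local lemma: each further element multiplies the number of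
  good colorings by at least \<open>k / 2\<close>.
\<close>

lemma ex_coloring_many_colors:
  fixes F :: "'e set set"
  assumes E: "finite E"
    and F: "\<And>H. H \<in> F \<Longrightarrow> H \<subseteq> E \<and> card H = m" "0 < m"
    and deg: "\<And>e. e \<in> E \<Longrightarrow> card {H \<in> F. e \<in> H} \<le> D"
    and k: "2 ^ (d + 1) * 2 ^ m * m ^ d * D \<le> k ^ d" "0 < k"
  shows "\<exists>c. c ` E \<subseteq> {..<k} \<and> (\<forall>H\<in>F. m < card (c ` H) + d)"
proof -
  let ?N = "\<lambda>S. real (card (good_colorings F k d S))"
  have finF: "finite F"
    using F E by (meson PowI finite_Pow_iff finite_subset subsetI)
  have step: "real k / 2 * ?N (S - {e}) \<le> ?N S" if "finite S" "S \<subseteq> E" "e \<in> S" for S e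
    using that
  proof (induction S arbitrary: e rule: finite_psubset_induct)
    case (psubset S)
    \<comment> \<open>The elements of \<open>B\<close> are removed one by one, each at the cost of a
      factor \<open>k / 2\<close>; the sets involved are proper subsets of \<open>S\<close>, so the
      induction hypothesis applies. This yields the \<open>d\<close>-fold estimate that
      \<open>good_colorings_step\<close> asks for.\<close>
    have *: "(real k / 2) ^ card B * ?N (S - {e} - B) \<le> ?N (S - {e})"
      if "finite B" "B \<subseteq> S - {e}" for B
      using that
    proof (induction B rule: finite_induct)
      case (insert b B)
      have "real k / 2 * ?N (S - {e} - B - {b}) \<le> ?N (S - {e} - B)"
        using insert psubset by (intro psubset.IH) auto
      then have "(real k / 2) ^ card B * (real k / 2 * ?N (S - {e} - B - {b}))
          \<le> (real k / 2) ^ card B * ?N (S - {e} - B)"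
        by (rule mult_left_mono) simp
      also have "\<dots> \<le> ?N (S - {e})" using insert by simp
      also have "S - {e} - B - {b} = S - {e} - insert b B" by auto
      finally show ?case using insert by (simp add: mult_ac)
    qed simp
    show ?case
    proof (rule good_colorings_step[OF finF _ _ k])
      show "finite H \<and> card H = m" if "H \<in> F" for H
        using F(1)[OF that] E finite_subset by blast
      show "card {H \<in> F. e \<in> H} \<le> D"
        using psubset deg by blast
      show "(real k / 2) ^ d * ?N (S - {e} - B) \<le> ?N (S - {e})"
        if "B \<subseteq> S - {e}" "card B = d" for B
        using *[OF _ that(1)] that psubset.hyps by (metis finite_Diff finite_subset)
    qed (use psubset in auto)
  qed
  have "0 < ?N S" if "finite S" "S \<subseteq> E" for S
    using that
  proof (induction S rule: finite_induct)
    case empty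
    \<comment> \<open>The members of \<open>F\<close> are nonempty because \<open>0 < m\<close>, so
      the empty coloring meets no constraint.\<close>
    have "(\<lambda>_. undefined) \<in> good_colorings F k d {}"
      using F by (fastforce simp: good_colorings_def)
    then show ?case
      by (metis card_gt_0_iff empty_iff finite.emptyI finite_good_colorings of_nat_0_less_iff)
  next
    case (insert e S)
    then have "real k / 2 * ?N S \<le> ?N (insert e S)"
      using step[of "insert e S" e] by simp
    moreover have "0 < real k / 2 * ?N S" using insert k by simp
    ultimately show ?case by linarith
  qed
  from this[OF E order_refl] obtain c where "c \<in> good_colorings F k d E"
    by (metis all_not_in_conv card.empty less_irrefl of_nat_0)
  then show ?thesis
    using F(1) by (intro exI[of _ c]) (auto simp: good_colorings_def)
qed

section \<open>The minimum number of colors, and counting copies of a graph\<close>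

lemma ramsey_r_le:
  fixes c :: "'a set \<Rightarrow> nat"
  assumes "Hq_coloring G H q c"
  shows "ramsey_r G H q \<le> card (c ` edges G)"
  unfolding ramsey_r_def using assms by (intro Least_le) blast

lemma ramsey_r_attained:
  fixes G :: "'a graph" and H :: "'b graph"
  assumes "simple_graph G" "q \<le> card (edges H)"
  obtains c :: "'a set \<Rightarrow> nat" where "Hq_coloring G H q c" "ramsey_r G H q = card (c ` edges G)"
proof -
  have "\<exists>k. \<exists>c :: 'a set \<Rightarrow> nat. Hq_coloring G H q c \<and> card (c ` edges G) = k"
    using ex_Hq_coloring[OF assms] by blast
  from LeastI_ex[OF this] show thesis
    using that unfolding ramsey_r_def by metis
qed

lemma finite_edges: "simple_graph G \<Longrightarrow> finite (edges G)"
  using finite_imp_finite_nsets finite_subset unfolding simple_graph_def by blast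

text \<open>The inverse bijection carries edges back because every edge lies inside the vertex set.
  It presents a copy of \<open>H\<close> as an image of \<open>H\<close>, the form in which copies
  are counted.\<close>

lemma graph_iso_inverse:
  assumes "simple_graph F" "graph_iso F H" "simple_graph H"
  obtains f h where "bij_betw f (verts F) (verts H)" "bij_betw h (verts H) (verts F)"
    "\<And>v. v \<in> verts F \<Longrightarrow> h (f v) = v" "(`) f ` edges F = edges H" "(`) h ` edges H = edges F"
proof -
  obtain f where f: "bij_betw f (verts F) (verts H)" "(`) f ` edges F = edges H"
    using assms(2) unfolding graph_iso_def by blast
  define h where "h = inv_into (verts F) f"
  have hf: "h (f v) = v" if "v \<in> verts F" for v
    using f(1) that by (simp add: h_def bij_betw_inv_into_left)
  have "h ` f ` e = e" if "e \<in> edges F" for e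
  proof -
    have "e \<subseteq> verts F"
      using assms(1) that by (auto simp: simple_graph_def nsets_def)
    then show ?thesis using hf by (force simp: image_iff)
  qed
  then have "(`) h ` edges H = edges F"
    unfolding f(2)[symmetric] by (force simp: image_image)
  then show thesis
    using that f hf bij_betw_inv_into[OF f(1)] by (simp add: h_def)
qed

lemma card_edges_graph_iso:
  assumes "simple_graph F" "graph_iso F H" "simple_graph H"
  shows "card (edges F) = card (edges H)"
proof -
  obtain f h where "(`) f ` edges F = edges H" "(`) h ` edges H = edges F"
    using graph_iso_inverse[OF assms] by metis
  then show ?thesis
    using assms(1,3) card_image_le finite_edges by (metis le_antisym)
qed

text \<open>A copy through \<open>e = {x, y}\<close> is the image of \<open>H\<close> under a vertex
  map sending some \<open>a\<close> to \<open>x\<close> and some \<open>b\<close> to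
  \<open>y\<close>: at most \<open>card (verts H) ^ 2\<close> pairs, and
  \<open>card (verts G)\<close> values at each remaining vertex. Edge sets are counted, since they
  are all that a coloring sees.\<close>

lemma card_copies_through_edge:
  fixes G :: "'a graph" and H :: "'b graph"
  assumes G: "simple_graph G" and H: "simple_graph H" and e: "e \<in> edges G"
  shows "card {edges F | F. subgraph F G \<and> graph_iso F H \<and> e \<in> edges F}
           \<le> card (verts H) ^ 2 * card (verts G) ^ (card (verts H) - 2)"
proof -
  let ?V = "verts G" and ?W = "verts H"
  have fin: "finite ?V" "finite ?W" using G H by (auto simp: simple_graph_def)
  have "card e = 2" using e G by (auto simp: simple_graph_def nsets_def)
  then obtain x y where xy: "e = {x, y}" "x \<noteq> y" by (meson card_2_iff)
  define P where "P = {(a, b). a \<in> ?W \<and> b \<in> ?W \<and> a \<noteq> b}"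
  \<comment> \<open>Maps sending \<open>a\<close> to \<open>x\<close> and \<open>b\<close> to
    \<open>y\<close>, free elsewhere; non-injective ones only increase the count.\<close>
  define Q where "Q a b = PiE ?W (\<lambda>w. if w = a then {x} else if w = b then {y} else ?V)" for a b
  have P: "P \<subseteq> ?W \<times> ?W" by (auto simp: P_def)
  have finP: "finite P" "card P \<le> card ?W ^ 2"
    using finite_subset[OF P] card_mono[OF _ P] fin by (simp_all add: card_cartesian_product power2_eq_square)
  have Q: "finite (Q a b)" "card (Q a b) \<le> card ?V ^ (card ?W - 2)" if "(a, b) \<in> P" for a b
  proof -
    have ab: "a \<in> ?W" "b \<in> ?W" "a \<noteq> b" using that by (auto simp: P_def)
    show "finite (Q a b)" unfolding Q_def using fin by (intro finite_PiE) auto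
    let ?g = "\<lambda>w. card (if w = a then {x} else if w = b then {y} else ?V)"
    have W: "?W = insert a (insert b (?W - {a, b}))" using ab by auto
    have "card (Q a b) = prod ?g ?W" unfolding Q_def by (simp add: card_PiE fin)
    also have "\<dots> = prod ?g (?W - {a, b})"
      using ab fin by (subst W) (subst prod.insert; simp)+
    also have "\<dots> = (\<Prod>w\<in>?W - {a, b}. card ?V)" by (rule prod.cong) auto
    also have "\<dots> = card ?V ^ (card ?W - 2)"
      using ab fin by (simp add: numeral_2_eq_2)
    finally show "card (Q a b) \<le> card ?V ^ (card ?W - 2)" by simp
  qed
  have in_U: "edges F \<in> (\<Union>p\<in>P. (\<lambda>h. (`) h ` edges H) ` Q (fst p) (snd p))"
    if F: "subgraph F G" "graph_iso F H" "e \<in> edges F" for F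
  proof -
    have sF: "simple_graph F" "verts F \<subseteq> ?V" using F(1) by (auto simp: subgraph_def)
    obtain f h where f: "bij_betw f (verts F) ?W" and h: "bij_betw h ?W (verts F)"
      and hf: "\<And>v. v \<in> verts F \<Longrightarrow> h (f v) = v" and hH: "(`) h ` edges H = edges F"
      by (rule graph_iso_inverse[OF sF(1) F(2) H]) (rule that)
    have "e \<subseteq> verts F" using F(3) sF(1) by (auto simp: simple_graph_def nsets_def)
    then have xyF: "x \<in> verts F" "y \<in> verts F" using xy by auto
    have "f x \<noteq> f y" using hf xyF xy(2) by metis
    then have P: "(f x, f y) \<in> P"
      using f xyF unfolding P_def by (simp add: bij_betw_apply)
    have Q: "restrict h ?W \<in> Q (f x) (f y)"
      unfolding Q_def using hf xyF subsetD[OF sF(2)] bij_betw_apply[OF h] by auto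
    have h_eq: "edges F = (`) (restrict h ?W) ` edges H"
    proof -
      have *: "restrict h ?W ` e' = h ` e'" if "e' \<in> edges H" for e'
      proof -
        have "e' \<subseteq> ?W" using that H by (auto simp: simple_graph_def nsets_def)
        then show ?thesis by auto
      qed
      show ?thesis unfolding hH[symmetric] by (rule image_cong[OF refl]) (rule *[symmetric])
    qed
    show ?thesis
      by (rule UN_I[OF P], unfold fst_conv snd_conv) (rule image_eqI[OF _ Q], rule h_eq)
  qed
  have sub: "{edges F | F. subgraph F G \<and> graph_iso F H \<and> e \<in> edges F}
      \<subseteq> (\<Union>p\<in>P. (\<lambda>h. (`) h ` edges H) ` Q (fst p) (snd p))"
  proof
    fix E assume "E \<in> {edges F | F. subgraph F G \<and> graph_iso F H \<and> e \<in> edges F}"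
    then obtain F where F: "E = edges F" "subgraph F G" "graph_iso F H" "e \<in> edges F"
      by blast
    show "E \<in> (\<Union>p\<in>P. (\<lambda>h. (`) h ` edges H) ` Q (fst p) (snd p))"
      unfolding F(1) by (rule in_U[OF F(2-4)])
  qed
  have "finite (\<Union>p\<in>P. (\<lambda>h. (`) h ` edges H) ` Q (fst p) (snd p))"
    using finP Q by auto
  from card_mono[OF this sub]
  have "real (card {edges F | F. subgraph F G \<and> graph_iso F H \<and> e \<in> edges F})
      \<le> real (card (\<Union>p\<in>P. (\<lambda>h. (`) h ` edges H) ` Q (fst p) (snd p)))"
    by (simp only: of_nat_le_iff)
  also have "\<dots> \<le> real (card ?W ^ 2) * real (card ?V ^ (card ?W - 2))"
  proof (rule card_UN_le_mult[OF finP])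
    fix p assume "p \<in> P"
    then have p: "(fst p, snd p) \<in> P" by simp
    show "real (card ((\<lambda>h. (`) h ` edges H) ` Q (fst p) (snd p))) \<le> real (card ?V ^ (card ?W - 2))"
      using card_image_le[OF Q(1)[OF p], of "\<lambda>h. (`) h ` edges H"] Q(2)[OF p]
      unfolding of_nat_le_iff by linarith
  qed simp
  finally show ?thesis by (simp only: of_nat_le_iff flip: of_nat_mult)
qed

text \<open>The set system consists of the edge sets of copies of \<open>H\<close>:
  \<open>card_copies_through_edge\<close> bounds its degree, and
  \<open>ex_coloring_many_colors\<close> gives each copy more than \<open>card (edges H) - d\<close>
  colors, hence at least \<open>q\<close>.\<close>

lemma ramsey_r_le_local:
  fixes G :: "'a graph" and H :: "'b graph"
  assumes G: "simple_graph G" and H: "simple_graph H" "edges H \<noteq> {}"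
    and k: "2 ^ (d + 1) * 2 ^ card (edges H) * card (edges H) ^ d *
      (card (verts H) ^ 2 * card (verts G) ^ (card (verts H) - 2)) \<le> k ^ d" "0 < k"
    and q: "q + d \<le> card (edges H) + 1"
  shows "ramsey_r G H q \<le> k"
proof -
  define \<F> where "\<F> = {edges F | F. subgraph F G \<and> graph_iso F H}"
  have "\<exists>c. c ` edges G \<subseteq> {..<k} \<and> (\<forall>E\<in>\<F>. card (edges H) < card (c ` E) + d)"
  proof (rule ex_coloring_many_colors[OF finite_edges[OF G] _ _ _ k])
    show "E \<subseteq> edges G \<and> card E = card (edges H)" if "E \<in> \<F>" for E
      using that card_edges_graph_iso[OF _ _ H(1)] by (auto simp: \<F>_def subgraph_def)
    show "0 < card (edges H)" using H finite_edges by (simp add: card_gt_0_iff)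
    fix e assume e: "e \<in> edges G"
    have "{E \<in> \<F>. e \<in> E} = {edges F | F. subgraph F G \<and> graph_iso F H \<and> e \<in> edges F}"
      by (auto simp: \<F>_def)
    then show "card {E \<in> \<F>. e \<in> E} \<le>
        card (verts H) ^ 2 * card (verts G) ^ (card (verts H) - 2)"
      using card_copies_through_edge[OF G H(1) e] by simp
  qed
  then obtain c where c: "c ` edges G \<subseteq> {..<k}" "\<And>E. E \<in> \<F> \<Longrightarrow> card (edges H) < card (c ` E) + d"
    by blast
  have "Hq_coloring G H q c"
    unfolding Hq_coloring_def
  proof (intro allI impI)
    fix F assume "subgraph F G \<and> graph_iso F H"
    then have "edges F \<in> \<F>" by (auto simp: \<F>_def)
    from c(2)[OF this] q show "q \<le> card (c ` edges F)" by linarith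
  qed
  from ramsey_r_le[OF this] card_mono[OF _ c(1)] show ?thesis by simp
qed

section \<open>Copies inside complete bipartite graphs\<close>

lemma verts_complete_bipartite: "verts (complete_bipartite m n) = {..<m} <+> {..<n}"
  by (simp add: complete_bipartite_def)

lemma edges_complete_bipartite:
  "edges (complete_bipartite m n) = {{Inl i, Inr j} | i j. i < m \<and> j < n}"
  by (simp add: complete_bipartite_def)

text \<open>These copies, with the part of size \<open>s\<close> on the left, are the ones on which
  the lower bounds test a coloring.\<close>

lemma complete_bipartite_subgraph:
  assumes S: "S \<subseteq> {..<m}" "card S = s" and T: "T \<subseteq> {..<n}" "card T = t"
  defines "F \<equiv> Graph (S <+> T) {{Inl i, Inr j} | i j. i \<in> S \<and> j \<in> T}"
  shows "subgraph F (complete_bipartite m n)" "graph_iso F (complete_bipartite s t)"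
proof -
  have fin: "finite S" "finite T" using S T finite_subset by auto
  then have "simple_graph F"
    by (auto simp: F_def simple_graph_def nsets_def)
  then show "subgraph F (complete_bipartite m n)"
    using S T by (auto simp: F_def subgraph_def complete_bipartite_def)
  obtain f where f: "bij_betw f S {..<s}"
    using fin S by (metis ex_bij_betw_finite_nat atLeast0LessThan)
  obtain g where g: "bij_betw g T {..<t}"
    using fin T by (metis ex_bij_betw_finite_nat atLeast0LessThan)
  have "bij_betw (map_sum f g) (S <+> T) ({..<s} <+> {..<t})"
  proof (rule bij_betw_imageI)
    show "inj_on (map_sum f g) (S <+> T)"
      by (rule inj_onI) (use f g in \<open>auto simp: bij_betw_def dest: inj_onD\<close>)
    have "map_sum f g ` (S <+> T) = f ` S <+> g ` T"
      by (simp add: Plus_def image_Un image_image)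
    then show "map_sum f g ` (S <+> T) = {..<s} <+> {..<t}"
      using f g by (simp add: bij_betw_def)
  qed
  moreover have "(`) (map_sum f g) ` edges F = edges (complete_bipartite s t)"
  proof (intro equalityI subsetI)
    fix e assume "e \<in> (`) (map_sum f g) ` edges F"
    then obtain i j where ij: "i \<in> S" "j \<in> T" "e = {Inl (f i), Inr (g j)}"
      by (auto simp: F_def)
    then have "f i < s" "g j < t"
      using f g by (auto simp: bij_betw_def)
    then show "e \<in> edges (complete_bipartite s t)"
      using ij by (auto simp: edges_complete_bipartite)
  next
    fix e assume "e \<in> edges (complete_bipartite s t)"
    then obtain i j where e: "i < s" "j < t" "e = {Inl i, Inr j}"
      by (auto simp: edges_complete_bipartite)
    then have "i \<in> f ` S" "j \<in> g ` T" using f g by (auto simp: bij_betw_def)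
    then obtain i' j' where ij: "i' \<in> S" "j' \<in> T" "e = map_sum f g ` {Inl i', Inr j'}"
      using e by auto
    show "e \<in> (`) (map_sum f g) ` edges F"
      unfolding ij(3) by (rule imageI) (use ij in \<open>auto simp: F_def\<close>)
  qed
  ultimately show "graph_iso F (complete_bipartite s t)"
    unfolding graph_iso_def by (auto simp: F_def verts_complete_bipartite)
qed

lemma Hq_coloring_complete_bipartiteD:
  assumes "Hq_coloring (complete_bipartite m n) (complete_bipartite s t) q c"
    and "S \<subseteq> {..<m}" "card S = s" "T \<subseteq> {..<n}" "card T = t"
  shows "q \<le> card ((\<lambda>(i, j). c {Inl i, Inr j}) ` (S \<times> T))"
proof -
  have "(\<lambda>(i, j). c {Inl i, Inr j}) ` (S \<times> T) = c ` {{Inl i, Inr j} | i j. i \<in> S \<and> j \<in> T}"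
    by force
  then show ?thesis
    using assms(1) complete_bipartite_subgraph[OF assms(2-)] unfolding Hq_coloring_def by fastforce
qed

section \<open>Stars: colorings versus functions on the leaves\<close>

text \<open>An optimal coloring is read along the edges at \<open>Inl 0\<close>; any
  \<open>t\<close> of them form a star, so \<open>h\<close> inherits the color condition.\<close>

lemma star_coloring_at_vertex:
  assumes "q \<le> t" "0 < n"
  obtains h :: "nat \<Rightarrow> nat"
  where "card (h ` {..<n}) \<le> ramsey_r (complete_bipartite n n) (complete_bipartite 1 t) q"
    and "\<And>J. J \<subseteq> {..<n} \<Longrightarrow> card J = t \<Longrightarrow> q \<le> card (h ` J)"
proof -
  let ?G = "complete_bipartite n n"
  obtain c :: "(nat + nat) set \<Rightarrow> nat" where c: "Hq_coloring ?G (complete_bipartite 1 t) q c"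
    "ramsey_r ?G (complete_bipartite 1 t) q = card (c ` edges ?G)"
    by (rule ramsey_r_attained[of ?G q "complete_bipartite 1 t"])
      (use assms in \<open>auto simp: simple_graph_complete_bipartite card_edges_complete_bipartite\<close>)
  let ?h = "\<lambda>j. c {Inl 0, Inr j}"
  show thesis
  proof (rule that[of ?h])
    have "?h ` {..<n} \<subseteq> c ` edges ?G"
      using assms(2) by (auto simp: edges_complete_bipartite)
    then show "card (?h ` {..<n}) \<le> ramsey_r ?G (complete_bipartite 1 t) q"
      unfolding c(2)
      by (intro card_mono) (auto intro!: finite_edges simple_graph_complete_bipartite)
    fix J assume J: "J \<subseteq> {..<n}" "card J = t"
    have "?h ` J = (\<lambda>(i, j). c {Inl i, Inr j}) ` ({0} \<times> J)" by force
    then show "q \<le> card (?h ` J)"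
      using Hq_coloring_complete_bipartiteD[OF c(1), of "{0}" J] J assms(2) by simp
  qed
qed

text \<open>The center \<open>w\<close> is the image of \<open>Inl 0\<close> and may lie in either
  part.\<close>

lemma star_copy_edges:
  assumes "subgraph F G" "graph_iso F (complete_bipartite 1 t)"
  obtains w where "edges F \<subseteq> {e \<in> edges G. w \<in> e}" "card (edges F) = t"
proof -
  have sF: "simple_graph F" "edges F \<subseteq> edges G" using assms(1) by (auto simp: subgraph_def)
  obtain h where h: "(`) h ` edges (complete_bipartite 1 t) = edges F"
    using graph_iso_inverse[OF sF(1) assms(2) simple_graph_complete_bipartite] by metis
  have "edges F \<subseteq> {e \<in> edges G. h (Inl 0) \<in> e}"
    using sF(2) unfolding h[symmetric] by (auto simp: edges_complete_bipartite)
  moreover have "card (edges F) = t"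
    using card_edges_graph_iso[OF sF(1) assms(2) simple_graph_complete_bipartite]
    by (simp add: card_edges_complete_bipartite)
  ultimately show thesis by (rule that)
qed

lemma inj_on_add_mod: "inj_on (\<lambda>j. (i + j) mod n) {..<n}" for i n :: nat
proof (rule inj_onI)
  fix x y assume xy: "x \<in> {..<n}" "y \<in> {..<n}" "(i + x) mod n = (i + y) mod n"
  then have "int n dvd int x - int y"
    by (metis add_diff_cancel_left mod_eq_dvd_iff of_nat_add of_nat_mod)
  then have "\<not> \<bar>int x - int y\<bar> < int n \<or> x = y"
    using zdvd_not_zless[of "\<bar>int x - int y\<bar>" "int n"] by auto
  then show "x = y" using xy by auto
qed

text \<open>Composing \<open>g\<close> with the cyclic Latin square \<open>(i, j) \<mapsto> (i + j) mod n\<close>.\<close>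

lemma ramsey_r_star_le:
  fixes g :: "nat \<Rightarrow> nat"
  assumes g: "\<And>J. J \<subseteq> {..<n} \<Longrightarrow> card J = t \<Longrightarrow> q \<le> card (g ` J)" and "0 < n"
  shows "ramsey_r (complete_bipartite n n) (complete_bipartite 1 t) q \<le> card (g ` {..<n})"
proof -
  let ?G = "complete_bipartite n n"
  \<comment> \<open>Summing over the end vertices with their tags stripped yields
    \<open>(i + j) mod n\<close> without orienting the edge.\<close>
  define c where "c e = (\<Sum>v\<in>e. case_sum id id v) mod n" for e :: "(nat + nat) set"
  have c: "c {Inl i, Inr j} = (i + j) mod n" for i j by (simp add: c_def)
  \<comment> \<open>At a fixed vertex one index is constant, so \<open>c\<close> is a translation
    modulo \<open>n\<close>. A star thus has \<open>t\<close> distinct values of \<open>c\<close>,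
    and \<open>g\<close> applies to that set of values.\<close>
  have inj: "inj_on c {e \<in> edges ?G. w \<in> e}" for w
  proof (cases w)
    case (Inl i)
    have *: "{e \<in> edges ?G. w \<in> e} \<subseteq> (\<lambda>j. {Inl i, Inr j}) ` {..<n}"
      using Inl by (auto simp: edges_complete_bipartite)
    have "inj_on c ((\<lambda>j. {Inl i, Inr j}) ` {..<n})"
      by (rule inj_on_imageI) (simp add: comp_def c inj_on_add_mod)
    then show ?thesis using * by (rule inj_on_subset)
  next
    case (Inr i)
    have *: "{e \<in> edges ?G. w \<in> e} \<subseteq> (\<lambda>j. {Inl j, Inr i}) ` {..<n}"
      using Inr by (auto simp: edges_complete_bipartite)
    have "inj_on c ((\<lambda>j. {Inl j, Inr i}) ` {..<n})"
      by (rule inj_on_imageI) (simp add: comp_def c add.commute[of _ i] inj_on_add_mod)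
    then show ?thesis using * by (rule inj_on_subset)
  qed
  have "Hq_coloring ?G (complete_bipartite 1 t) q (g \<circ> c)"
    unfolding Hq_coloring_def
  proof (intro allI impI)
    fix F assume "subgraph F ?G \<and> graph_iso F (complete_bipartite 1 t)"
    then obtain w where w: "edges F \<subseteq> {e \<in> edges ?G. w \<in> e}" "card (edges F) = t"
      using star_copy_edges by blast
    then have "card (c ` edges F) = t"
      using inj_on_subset[OF inj w(1)] by (simp add: card_image)
    moreover have "c ` edges F \<subseteq> {..<n}" using assms(2) by (auto simp: c_def)
    ultimately show "q \<le> card ((g \<circ> c) ` edges F)"
      using g[of "c ` edges F"] by (simp add: image_comp)
  qed
  then have "ramsey_r ?G (complete_bipartite 1 t) q \<le> card ((g \<circ> c) ` edges ?G)"
    by (rule ramsey_r_le)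
  also have "\<dots> \<le> card (g ` {..<n})"
    using assms(2) by (intro card_mono) (auto simp: c_def)
  finally show ?thesis .
qed

section \<open>Functions taking many values on every \<open>t\<close>-set\<close>

text \<open>Discarding a lightest element never lowers the average weight; this is repeated until
  \<open>r\<close> elements remain. The comparison of averages is cross-multiplied to stay in the
  naturals.\<close>

lemma heavy_subset:
  fixes w :: "'a \<Rightarrow> nat"
  assumes "finite I" "r \<le> card I"
  shows "\<exists>Q\<subseteq>I. card Q = r \<and> r * sum w I \<le> card I * sum w Q"
  using assms
proof (induction "card I - r" arbitrary: I)
  case 0
  then show ?case by (intro exI[of _ I]) auto
next
  case (Suc m)
  then have "I \<noteq> {}" by auto
  then obtain x where x: "x \<in> I" "\<And>y. y \<in> I \<Longrightarrow> w x \<le> w y"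
    using ex_is_arg_min_if_finite[OF Suc.prems(1), of w] by (auto simp: is_arg_min_linorder)
  let ?I = "I - {x}"
  have cI: "card I = Suc (card ?I)" by (rule card.remove[OF Suc.prems(1) x(1)])
  then have "m = card ?I - r" "r \<le> card ?I" using Suc.hyps(2) by linarith+
  then obtain Q where Q: "Q \<subseteq> ?I" "card Q = r" "r * sum w ?I \<le> card ?I * sum w Q"
    using Suc.hyps(1)[of ?I] Suc.prems(1) by blast
  have sI: "sum w I = w x + sum w ?I" by (rule sum.remove[OF Suc.prems(1) x(1)])
  have avg: "card ?I * w x \<le> sum w ?I"
    using sum_bounded_below[of ?I "w x" w] x by simp
  have "r * sum w I \<le> card I * sum w Q"
  \<comment> \<open>The argument cancels \<open>card ?I\<close>; if it vanishes,
    \<open>r < card I\<close> forces \<open>r = 0\<close>.\<close>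
  proof (cases "card ?I = 0")
    case True
    then have "r = 0" using Suc.hyps(2) cI by simp
    then show ?thesis by simp
  next
    case False
    have "card ?I * (r * sum w I) = r * (card ?I * w x + card ?I * sum w ?I)"
      by (simp add: sI algebra_simps)
    also have "\<dots> \<le> r * (card I * sum w ?I)"
      using avg cI by (intro mult_left_mono) auto
    also have "\<dots> = card I * (r * sum w ?I)" by simp
    also have "\<dots> \<le> card I * (card ?I * sum w Q)" using Q(3) by (rule mult_left_mono) simp
    also have "\<dots> = card ?I * (card I * sum w Q)" by simp
    finally show ?thesis using False by (simp only: mult_le_cancel1)
  qed
  then show ?case using Q by blast
qed

text \<open>The union of \<open>q - 1\<close> color classes has fewer than \<open>t\<close>
  elements, as otherwise it would contain a \<open>t\<close>-set with too few colors. Applied to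
  \<open>q - 1\<close> classes of at least average size, this bounds the average class size.\<close>

lemma many_colors_average:
  assumes A: "finite A" "t \<le> card A" "0 < t"
    and h: "\<And>J. J \<subseteq> A \<Longrightarrow> card J = t \<Longrightarrow> q \<le> card (h ` J)" and q: "0 < q"
  shows "(q - 1) * card A \<le> card (h ` A) * (t - 1)"
proof -
  have few: "card J < t" if J: "J \<subseteq> A" "card (h ` J) < q" for J
  proof (rule ccontr)
    assume "\<not> card J < t"
    then obtain J' where J': "J' \<subseteq> J" "card J' = t"
      by (meson not_less obtain_subset_with_card_n)
    have "card (h ` J') \<le> card (h ` J)"
      using J A J' by (intro card_mono finite_imageI) (auto intro: finite_subset)
    moreover have "q \<le> card (h ` J')" using h[of J'] J J' by auto
    ultimately show False using J by simp
  qed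
  \<comment> \<open>Guarantees that there are \<open>q - 1\<close> classes to choose.\<close>
  have "q \<le> card (h ` A)" using few[of A] A by fastforce
  define w where "w x = card {a \<in> A. h a = x}" for x
  have w: "sum w X = card {a \<in> A. h a \<in> X}" if "finite X" for X
  proof -
    have "{a \<in> A. h a \<in> X} = (\<Union>x\<in>X. {a \<in> A. h a = x})" by auto
    also have "card \<dots> = sum w X"
      unfolding w_def using that A by (intro card_UN_disjoint) auto
    finally show ?thesis by simp
  qed
  obtain Q where Q: "Q \<subseteq> h ` A" "card Q = q - 1"
    "(q - 1) * sum w (h ` A) \<le> card (h ` A) * sum w Q"
    using heavy_subset[of "h ` A" "q - 1" w] A \<open>q \<le> card (h ` A)\<close>
    by (meson diff_le_self finite_imageI le_trans)
  have finQ: "finite Q" using Q A finite_subset by blast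
  have "card (h ` {a \<in> A. h a \<in> Q}) \<le> card Q"
    using finQ by (intro card_mono) auto
  then have "card (h ` {a \<in> A. h a \<in> Q}) < q" using Q(2) q by simp
  then have "sum w Q < t"
    using few[of "{a \<in> A. h a \<in> Q}"] w[OF finQ] by simp
  then have "sum w Q \<le> t - 1" by simp
  moreover have "sum w (h ` A) = card A"
    using w[of "h ` A"] A by (metis (no_types, lifting) Collect_cong Collect_mem_eq finite_imageI imageI)
  ultimately show ?thesis
    using Q(3) by (metis le_trans mult_le_mono2)
qed

text \<open>If the claim fails, representatives \<open>R\<close> of the colors leave at least
  \<open>t - q + 1\<close> elements over. That many of them form \<open>E\<close>, whose colors
  number at most \<open>t - q + 1 \<le> q - 1\<close> because \<open>t + 2 \<le> 2 * q\<close>.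
  Hence \<open>q - 1\<close> representatives can include all colors of \<open>E\<close>, and
  together with \<open>E\<close> they form a \<open>t\<close>-set with only \<open>q - 1\<close>
  colors.\<close>

lemma many_colors_strong:
  assumes A: "finite A" "t \<le> card A"
    and h: "\<And>J. J \<subseteq> A \<Longrightarrow> card J = t \<Longrightarrow> q \<le> card (h ` J)" and q: "t + 2 \<le> 2 * q" "q \<le> t"
  shows "card A + q \<le> card (h ` A) + t"
proof (rule ccontr)
  assume neg: "\<not> ?thesis"
  obtain R where R: "R \<subseteq> A" "inj_on h R" "h ` R = h ` A"
    using subset_image_inj[of "h ` A" h A] by auto
  have finR: "finite R" using R A finite_subset by blast
  have cR: "card R = card (h ` A)" using R by (metis card_image)
  have "q \<le> card (h ` A)"
  proof -
    obtain J where "J \<subseteq> A" "card J = t" using A by (meson obtain_subset_with_card_n)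
    with h[of J] A show ?thesis
      by (meson card_mono finite_imageI image_mono le_trans)
  qed
  have "t - q + 1 \<le> card (A - R)"
    using R A finR neg cR q by (simp add: card_Diff_subset)
  then obtain E where E: "E \<subseteq> A - R" "card E = t - q + 1"
    by (meson obtain_subset_with_card_n)
  have finE: "finite E" using E A by (meson finite_Diff finite_subset)
  define R0 where "R0 = {r \<in> R. h r \<in> h ` E}"
  have "h ` R0 = h ` R \<inter> h ` E" unfolding R0_def by blast
  also have "\<dots> = h ` E" using R(3) E(1) by blast
  finally have hR0: "h ` R0 = h ` E" .
  have "card R0 = card (h ` R0)"
    using inj_on_subset[OF R(2)] by (simp add: R0_def card_image)
  also have "\<dots> \<le> card E" using hR0 finE card_image_le by metis
  finally have "card R0 \<le> q - 1" using E q by simp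
  moreover have "q - 1 \<le> card R" using cR \<open>q \<le> card (h ` A)\<close> by simp
  moreover have "R0 \<subseteq> R" by (auto simp: R0_def)
  ultimately obtain R1 where R1: "R0 \<subseteq> R1" "R1 \<subseteq> R" "card R1 = q - 1"
    using exists_subset_between[of R0 "q - 1" R] finR by metis
  have finR1: "finite R1" using R1 finR finite_subset by blast
  have "card (E \<union> R1) = card E + card R1"
    using E R1 finE finR1 by (intro card_Un_disjoint) auto
  then have "card (E \<union> R1) = t" using E R1 q by simp
  moreover have "E \<union> R1 \<subseteq> A" using E R1 R by auto
  ultimately have "q \<le> card (h ` (E \<union> R1))" by (rule h[rotated])
  also have "h ` (E \<union> R1) = h ` R1" using R1(1) hR0 by blast
  also have "card \<dots> \<le> q - 1" using R1 finR1 card_image_le by metis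
  finally show False using q by simp
qed

lemma card_le_mult_card_div:
  fixes J :: "nat set"
  assumes "finite J" "0 < a"
  shows "card J \<le> a * card ((\<lambda>x. x div a) ` J)"
proof -
  have "x \<in> {x div a * a..<x div a * a + a}" for x
    using dividend_less_div_times[OF assms(2), of x] by (simp add: add.commute)
  then have "J \<subseteq> (\<Union>y\<in>(\<lambda>x. x div a) ` J. {y * a..<y * a + a})"
    by blast
  then have "card J \<le> card (\<Union>y\<in>(\<lambda>x. x div a) ` J. {y * a..<y * a + a})"
    using assms(1) by (intro card_mono) auto
  also have "\<dots> \<le> (\<Sum>y\<in>(\<lambda>x. x div a) ` J. card {y * a..<y * a + a})"
    using assms(1) by (intro card_UN_le) auto
  finally show ?thesis by (simp add: mult.commute)
qed

section \<open>The linear lower bound for \<open>K\<^sub>s\<^sub>,\<^sub>t\<close>\<close>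

text \<open>
  If \<open>2 k t < n\<close>, where \<open>k\<close> is the number of colors, some edge \<open>{u, v}\<close> has the same color as
  \<open>t\<close> edges at \<open>u\<close> and \<open>t\<close> edges at \<open>v\<close>. They span a \<open>K\<^sub>s\<^sub>,\<^sub>t\<close> with \<open>s + t - 1\<close> edges of one color.
\<close>

lemma ramsey_r_complete_bipartite_linear:
  assumes st: "0 < s" "s \<le> t" "0 < n" and q: "q = (s - 1) * (t - 1) + 2" "q \<le> s * t"
  shows "n \<le> 2 * ramsey_r (complete_bipartite n n) (complete_bipartite s t) q * t"
proof (rule ccontr)
  let ?G = "complete_bipartite n n"
  assume neg: "\<not> ?thesis"
  obtain c :: "(nat + nat) set \<Rightarrow> nat" where c: "Hq_coloring ?G (complete_bipartite s t) q c"
    "ramsey_r ?G (complete_bipartite s t) q = card (c ` edges ?G)"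
    by (rule ramsey_r_attained[of ?G q "complete_bipartite s t"])
      (use q in \<open>auto simp: simple_graph_complete_bipartite card_edges_complete_bipartite\<close>)
  define K where "K = c ` edges ?G"
  have finK: "finite K"
    unfolding K_def by (intro finite_imageI finite_edges simple_graph_complete_bipartite)
  define \<phi> where "\<phi> i j = c {Inl i, Inr j}" for i j :: nat
  have \<phi>K: "\<phi> i j \<in> K" if "i < n" "j < n" for i j
    using that by (auto simp: \<phi>_def K_def edges_complete_bipartite)
  define L where "L i x = {j. j < n \<and> \<phi> i j = x}" for i x
  define R where "R j x = {i. i < n \<and> \<phi> i j = x}" for j x
  \<comment> \<open>Pairs whose color occurs fewer than \<open>t\<close> times at the left end,
    respectively the right end. \<open>RB\<close> lists the right end first, hence the later
    \<open>prod.swap\<close>.\<close>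
  define LB where "LB = (SIGMA i:{..<n}. \<Union>x\<in>{x \<in> K. card (L i x) < t}. L i x)"
  define RB where "RB = (SIGMA j:{..<n}. \<Union>x\<in>{x \<in> K. card (R j x) < t}. R j x)"
  have finLR: "finite (L i x)" "finite (R i x)" for i x by (auto simp: L_def R_def)
  have light: "card (SIGMA i:{..<n}. \<Union>x\<in>{x \<in> K. card (X i x) < t}. X i x) \<le> n * (card K * t)"
    if X: "\<And>i x. finite (X i x)" for X :: "nat \<Rightarrow> nat \<Rightarrow> nat set"
  proof -
    have "card (\<Union>x\<in>{x \<in> K. card (X i x) < t}. X i x) \<le> card K * t" for i
    proof -
      have "card (\<Union>x\<in>{x \<in> K. card (X i x) < t}. X i x)
          \<le> (\<Sum>x\<in>{x \<in> K. card (X i x) < t}. card (X i x))"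
        using finK by (intro card_UN_le) auto
      also have "\<dots> \<le> card {x \<in> K. card (X i x) < t} * t"
        using sum_bounded_above[of "{x \<in> K. card (X i x) < t}" "\<lambda>x. card (X i x)" t] by auto
      also have "\<dots> \<le> card K * t"
        using finK by (intro mult_right_mono card_mono) auto
      finally show ?thesis .
    qed
    then have "(\<Sum>i<n. card (\<Union>x\<in>{x \<in> K. card (X i x) < t}. X i x)) \<le> n * (card K * t)"
      using sum_bounded_above[of "{..<n}" _ "card K * t"] by simp
    then show ?thesis using finK X by (subst card_SigmaI) auto
  qed
  have fin: "finite LB" "finite RB"
    unfolding LB_def RB_def using finK finLR by auto
  have "card (LB \<union> prod.swap ` RB) \<le> card LB + card RB"
    using card_Un_le[of LB "prod.swap ` RB"] card_image_le[OF fin(2), of prod.swap] by linarith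
  also have "\<dots> \<le> n * (card K * t) + n * (card K * t)"
    unfolding LB_def RB_def using light finLR by (intro add_mono) auto
  also have "\<dots> = n * (2 * card K * t)" by simp
  also have "\<dots> < n * n"
    using neg c(2) st by (simp add: K_def)
  also have "\<dots> = card ({..<n} \<times> {..<n})" by (simp add: card_cartesian_product)
  finally have "\<not> {..<n} \<times> {..<n} \<subseteq> LB \<union> prod.swap ` RB"
    using fin by (meson card_mono finite_UnI finite_imageI not_less)
  then obtain u v where uv: "u < n" "v < n" "(u, v) \<notin> LB" "(u, v) \<notin> prod.swap ` RB"
    unfolding subset_iff by auto
  define x where "x = \<phi> u v"
  have "t \<le> card (L u x)"
    using uv \<phi>K[of u v] by (auto simp: LB_def L_def x_def not_less)
  have "(v, u) \<notin> RB" using uv(4) by force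
  then have "s \<le> card (R v x)"
    using uv \<phi>K[of u v] st by (force simp: RB_def R_def x_def not_less)
  \<comment> \<open>With \<open>v\<close> in \<open>T\<close> and \<open>u\<close> in
    \<open>S\<close>, row \<open>u\<close> and column \<open>v\<close> of
    \<open>S \<times> T\<close> have the single color \<open>x\<close>; the other
    \<open>(s - 1) * (t - 1)\<close> pairs bring the total to at most \<open>q - 1\<close>.\<close>
  obtain T where T: "{v} \<subseteq> T" "T \<subseteq> L u x" "card T = t"
    using exists_subset_between[of "{v}" t "L u x"] \<open>t \<le> card (L u x)\<close> uv st finLR
    by (auto simp: L_def x_def)
  obtain S where S: "{u} \<subseteq> S" "S \<subseteq> R v x" "card S = s"
    using exists_subset_between[of "{u}" s "R v x"] \<open>s \<le> card (R v x)\<close> uv st finLR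
    by (auto simp: R_def x_def)
  have finST: "finite S" "finite T"
    using finite_subset[OF S(2)] finite_subset[OF T(2)] finLR by simp_all
  have "q \<le> card ((\<lambda>(i, j). c {Inl i, Inr j}) ` (S \<times> T))"
    by (rule Hq_coloring_complete_bipartiteD[OF c(1)])
      (use S T in \<open>auto simp: L_def R_def\<close>)
  also have "\<dots> \<le> card (insert x ((\<lambda>(i, j). \<phi> i j) ` ((S - {u}) \<times> (T - {v}))))"
    using S T finST by (intro card_mono) (auto simp: \<phi>_def L_def R_def)
  also have "\<dots> \<le> Suc (card ((\<lambda>(i, j). \<phi> i j) ` ((S - {u}) \<times> (T - {v}))))"
    by (rule card_insert_le_m1) simp_all
  also have "\<dots> \<le> Suc (card ((S - {u}) \<times> (T - {v})))"
    using finST by (intro Suc_le_mono[THEN iffD2] card_image_le) simp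
  also have "\<dots> = Suc ((s - 1) * (t - 1))"
    using S T finST by (simp add: card_cartesian_product)
  finally show False using q by simp
qed

text \<open>The local bound asks for \<open>k ^ d\<close> of order \<open>n ^ (s + t - 2)\<close>,
  so \<open>k\<close> of order \<open>n powr \<alpha>\<close> suffices.\<close>

lemma ramsey_r_complete_bipartite_bigo:
  fixes s t d q :: nat
  assumes "0 < s" "0 < t" "0 < d" "q + d \<le> s * t + 1"
  shows "(\<lambda>n. real (ramsey_r (complete_bipartite n n) (complete_bipartite s t) q))
           \<in> O(\<lambda>n. real n powr (real (s + t - 2) / real d))"
proof -
  \<comment> \<open>The constants of \<open>ramsey_r_le_local\<close>; the last power of 2 arises
    because \<open>K\<^sub>n\<^sub>,\<^sub>n\<close> has \<open>2 * n\<close> vertices.\<close>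
  define C where "C = 2 ^ (d + 1) * 2 ^ (s * t) * (s * t) ^ d * ((s + t) ^ 2 * 2 ^ (s + t - 2))"
  define \<alpha> where "\<alpha> = real (s + t - 2) / real d"
  define B where "B = real C powr (1 / real d)"
  have C: "0 < C" using assms by (simp add: C_def)
  have B: "0 < B" using C by (simp add: B_def)
  have bound: "real (ramsey_r (complete_bipartite n n) (complete_bipartite s t) q)
      \<le> (B + 1) * real n powr \<alpha>" if n: "0 < n" for n
  proof -
    define k where "k = nat \<lceil>B * real n powr \<alpha>\<rceil>"
    have pos: "0 < B * real n powr \<alpha>" using B n by simp
    have k: "B * real n powr \<alpha> \<le> real k" "real k \<le> B * real n powr \<alpha> + 1"
      using pos unfolding k_def by linarith+
    have "0 < k" using k pos by (metis gr0I not_less of_nat_0)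
    \<comment> \<open>Absorbs the error of rounding \<open>k\<close> up, turning the constant
      \<open>B\<close> into \<open>B + 1\<close>.\<close>
    have "1 \<le> real n powr \<alpha>"
      using n by (intro ge_one_powr_ge_zero) (auto simp: \<alpha>_def)
    have "real (C * n ^ (s + t - 2)) = (B * real n powr \<alpha>) ^ d"
      using C n assms(3)
      by (simp add: B_def \<alpha>_def power_mult_distrib powr_powr flip: powr_realpow)
    also have "\<dots> \<le> real k ^ d" using k pos by (intro power_mono) auto
    finally have "C * n ^ (s + t - 2) \<le> k ^ d"
      by (metis of_nat_le_iff of_nat_power)
    moreover have "edges (complete_bipartite s t) \<noteq> {}"
      using card_edges_complete_bipartite[of s t] assms(1,2) by fastforce
    ultimately have "ramsey_r (complete_bipartite n n) (complete_bipartite s t) q \<le> k"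
      using assms \<open>0 < k\<close>
      by (intro ramsey_r_le_local[where d = d])
        (auto simp: simple_graph_complete_bipartite card_edges_complete_bipartite
          verts_complete_bipartite card_Plus C_def power_mult_distrib mult_ac simp flip: mult_2)
    then show ?thesis
      using k(2) \<open>1 \<le> real n powr \<alpha>\<close> by (simp add: algebra_simps)
  qed
  show ?thesis
    unfolding \<alpha>_def[symmetric]
    by (rule bigoI[of _ "B + 1"]) (use bound in \<open>auto intro!: eventually_at_top_linorderI[of 1]\<close>)
qed

section \<open>The two ranges of \<open>q\<close> for stars\<close>

text \<open>For \<open>n < t\<close> there is no star to test and one color suffices, so the lower
  bound then holds exactly when \<open>n\<close> is at most \<open>(t - 1) / (q - 1)\<close>; hence
  the disjunction guarding it. The upper bound colors the leaves in blocks of equal length.\<close>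

lemma ramsey_r_star_bounds:
  fixes t q n :: nat
  assumes "2 \<le> q" "2 * q \<le> t + 1" "0 < n"
  shows "t \<le> n \<or> real n \<le> (real t - 1) / (real q - 1) \<Longrightarrow>
      \<lceil>real n / ((real t - 1) / (real q - 1))\<rceil>
        \<le> int (ramsey_r (complete_bipartite n n) (complete_bipartite 1 t) q)" (is "_ \<Longrightarrow> _ \<le> int ?r")
    and "int (ramsey_r (complete_bipartite n n) (complete_bipartite 1 t) q)
        \<le> \<lceil>real n / real_of_int \<lfloor>(real t - 1) / (real q - 1)\<rfloor>\<rceil>"
proof -
  have pos: "0 < real t - 1" "0 < real q - 1" using assms by auto
  have "q \<le> t" using assms by simp
  obtain h :: "nat \<Rightarrow> nat" where h: "card (h ` {..<n}) \<le> ?r"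
    "\<And>J. J \<subseteq> {..<n} \<Longrightarrow> card J = t \<Longrightarrow> q \<le> card (h ` J)"
    using star_coloring_at_vertex[OF \<open>q \<le> t\<close> assms(3)] by blast
  {
    assume "t \<le> n \<or> real n \<le> (real t - 1) / (real q - 1)"
    then have "real n / ((real t - 1) / (real q - 1)) \<le> real ?r"
    proof
      assume "t \<le> n"
      then have "(q - 1) * n \<le> card (h ` {..<n}) * (t - 1)"
        using many_colors_average[of "{..<n}" t q h] h(2) assms by simp
      also have "\<dots> \<le> ?r * (t - 1)" using h(1) by (rule mult_right_mono) simp
      finally have "real ((q - 1) * n) \<le> real (?r * (t - 1))" by (simp only: of_nat_le_iff)
      then have "(real q - 1) * real n \<le> real ?r * (real t - 1)"
        using assms by (simp add: of_nat_diff)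
      then show ?thesis using pos by (simp add: field_simps)
    next
      assume "real n \<le> (real t - 1) / (real q - 1)"
      then have "real n / ((real t - 1) / (real q - 1)) \<le> 1"
        using pos by (subst divide_le_eq_1_pos) simp_all
      moreover have "1 \<le> ?r"
      proof -
        have "h ` {..<n} \<noteq> {}" using assms(3) by (simp add: lessThan_empty_iff)
        then have "0 < card (h ` {..<n})" by (simp add: card_gt_0_iff)
        then show ?thesis using h(1) by simp
      qed
      ultimately show ?thesis by linarith
    qed
    then show "\<lceil>real n / ((real t - 1) / (real q - 1))\<rceil> \<le> int ?r"
      by (simp add: ceiling_le_iff)
  }
  \<comment> \<open>The longest block length for which \<open>q - 1\<close> blocks hold fewer than
    \<open>t\<close> leaves.\<close>
  define a where "a = (t - 1) div (q - 1)"
  have "0 < a" using assms by (auto simp: a_def div_greater_zero_iff)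
  have a: "a * (q - 1) < t"
    using div_times_less_eq_dividend[of "t - 1" "q - 1"] assms unfolding a_def by linarith
  have floor: "\<lfloor>(real t - 1) / (real q - 1)\<rfloor> = int a"
    using floor_divide_of_nat_eq[of "t - 1" "q - 1", where 'a = real] assms
    by (simp add: a_def of_nat_diff)
  have "?r \<le> card ((\<lambda>x. x div a) ` {..<n})"
  proof (rule ramsey_r_star_le[OF _ assms(3)])
    fix J assume J: "J \<subseteq> {..<n}" "card J = t"
    then have "t \<le> a * card ((\<lambda>x. x div a) ` J)"
      using card_le_mult_card_div[of J a] \<open>0 < a\<close> finite_subset by blast
    then have "a * (q - 1) < a * card ((\<lambda>x. x div a) ` J)" using a by linarith
    then show "q \<le> card ((\<lambda>x. x div a) ` J)"
      using assms(1) by (simp only: mult_less_cancel1) linarith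
  qed
  also have "\<dots> \<le> nat \<lceil>real n / real a\<rceil>"
  proof -
    have "x div a < nat \<lceil>real n / real a\<rceil>" if "x < n" for x
    proof -
      have "real (x div a) \<le> real x / real a" by (rule of_nat_div_le_of_nat)
      also have "\<dots> < real n / real a" using that \<open>0 < a\<close> by (simp add: divide_strict_right_mono)
      also have "\<dots> \<le> real (nat \<lceil>real n / real a\<rceil>)" by (rule real_nat_ceiling_ge)
      finally show ?thesis by simp
    qed
    then have "(\<lambda>x. x div a) ` {..<n} \<subseteq> {..<nat \<lceil>real n / real a\<rceil>}" by auto
    from card_mono[OF _ this] show ?thesis by simp
  qed
  finally have "?r \<le> nat \<lceil>real n / real a\<rceil>" .
  moreover have "0 \<le> real n / real a" by simp
  then have "0 \<le> \<lceil>real n / real a\<rceil>" by linarith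
  ultimately show "int ?r \<le> \<lceil>real n / real_of_int \<lfloor>(real t - 1) / (real q - 1)\<rfloor>\<rceil>"
    by (simp only: floor of_int_of_nat_eq nat_le_iff)
qed

lemma ramsey_r_star_eq:
  fixes t q n :: nat
  assumes "t + 2 \<le> 2 * q" "q \<le> t" "t \<le> n" "0 < t"
  shows "ramsey_r (complete_bipartite n n) (complete_bipartite 1 t) q + t = n + q" (is "?r + t = _")
proof (rule antisym)
  have "0 < n" using assms by simp
  obtain h :: "nat \<Rightarrow> nat" where h: "card (h ` {..<n}) \<le> ?r"
    "\<And>J. J \<subseteq> {..<n} \<Longrightarrow> card J = t \<Longrightarrow> q \<le> card (h ` J)"
    using star_coloring_at_vertex[OF assms(2) \<open>0 < n\<close>] by blast
  have "n + q \<le> card (h ` {..<n}) + t"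
    using many_colors_strong[of "{..<n}" t q h] h(2) assms by simp
  then show "n + q \<le> ?r + t" using h(1) by simp
  \<comment> \<open>The leaves \<open>0\<close> to \<open>t - q\<close> share one color and all
    others are distinct. A \<open>t\<close>-set has at least \<open>q\<close> elements outside
    \<open>{..<t - q}\<close>, where \<open>max (t - q)\<close> is the identity.\<close>
  have "?r \<le> card (max (t - q) ` {..<n})"
  proof (rule ramsey_r_star_le[OF _ \<open>0 < n\<close>])
    fix J assume J: "J \<subseteq> {..<n}" "card J = t"
    then have fin: "finite J" using finite_subset by blast
    have "t - (t - q) \<le> card (J - {..<t - q})"
      using diff_card_le_card_Diff[of "{..<t - q}" J] J by simp
    also have "J - {..<t - q} \<subseteq> max (t - q) ` J" by (force simp: max_def)
    then have "card (J - {..<t - q}) \<le> card (max (t - q) ` J)"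
      using fin by (intro card_mono) auto
    finally show "q \<le> card (max (t - q) ` J)" using assms by simp
  qed
  also have "\<dots> \<le> card {t - q..<n}"
    using assms \<open>0 < n\<close> by (intro card_mono) auto
  finally show "?r + t \<le> n + q" using assms by simp
qed

section \<open>Assembling the three statements\<close>

theorem theorem1p1:
  fixes s t q :: nat
  assumes "0 < s" and "0 < t" and "0 < q"
  shows
    "(2 \<le> q \<and> real q \<le> (real t + 1) / 2 \<longrightarrow>
        (\<forall>n::nat. 0 < n \<longrightarrow>
           (t \<le> n \<or> real n \<le> (real t - 1) / (real q - 1) \<longrightarrow>
              \<lceil>real n / ((real t - 1) / (real q - 1))\<rceil>
                \<le> int (ramsey_r (complete_bipartite n n) (complete_bipartite 1 t) q)) \<and>
           int (ramsey_r (complete_bipartite n n) (complete_bipartite 1 t) q)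
             \<le> \<lceil>real n / real_of_int \<lfloor>(real t - 1) / (real q - 1)\<rfloor>\<rceil>))
     \<and> ((real t + 2) / 2 \<le> real q \<and> q \<le> t \<longrightarrow>
        (\<forall>n::nat. t \<le> n \<longrightarrow>
           int (ramsey_r (complete_bipartite n n) (complete_bipartite 1 t) q)
             = int n - int t + int q))
     \<and> (s \<le> t \<and> 2 \<le> s \<and> int q = int s * int t - int s - int t + 3 \<longrightarrow>
        (\<lambda>n::nat. real (ramsey_r (complete_bipartite n n) (complete_bipartite s t) q))
          \<in> \<Theta>(\<lambda>n. real n) \<and>
        (\<lambda>n::nat. real (ramsey_r (complete_bipartite n n) (complete_bipartite s t) (q - 1)))
          \<in> O(\<lambda>n. real n powr (1 - 1 / (real s + real t - 1))))"
proof (intro conjI)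
  show "2 \<le> q \<and> real q \<le> (real t + 1) / 2 \<longrightarrow>
        (\<forall>n::nat. 0 < n \<longrightarrow>
           (t \<le> n \<or> real n \<le> (real t - 1) / (real q - 1) \<longrightarrow>
              \<lceil>real n / ((real t - 1) / (real q - 1))\<rceil>
                \<le> int (ramsey_r (complete_bipartite n n) (complete_bipartite 1 t) q)) \<and>
           int (ramsey_r (complete_bipartite n n) (complete_bipartite 1 t) q)
             \<le> \<lceil>real n / real_of_int \<lfloor>(real t - 1) / (real q - 1)\<rfloor>\<rceil>)"
  proof (intro impI allI)
    fix n :: nat
    assume q: "2 \<le> q \<and> real q \<le> (real t + 1) / 2" and "0 < n"
    then have "real (2 * q) \<le> real (t + 1)" by simp
    then have "2 * q \<le> t + 1" by (simp only: of_nat_le_iff)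
    then show "(t \<le> n \<or> real n \<le> (real t - 1) / (real q - 1) \<longrightarrow>
              \<lceil>real n / ((real t - 1) / (real q - 1))\<rceil>
                \<le> int (ramsey_r (complete_bipartite n n) (complete_bipartite 1 t) q)) \<and>
           int (ramsey_r (complete_bipartite n n) (complete_bipartite 1 t) q)
             \<le> \<lceil>real n / real_of_int \<lfloor>(real t - 1) / (real q - 1)\<rfloor>\<rceil>"
      using ramsey_r_star_bounds q \<open>0 < n\<close> by blast
  qed
  show "(real t + 2) / 2 \<le> real q \<and> q \<le> t \<longrightarrow>
        (\<forall>n::nat. t \<le> n \<longrightarrow>
           int (ramsey_r (complete_bipartite n n) (complete_bipartite 1 t) q)
             = int n - int t + int q)"
  proof (intro impI allI)
    fix n :: nat
    assume q: "(real t + 2) / 2 \<le> real q \<and> q \<le> t" and n: "t \<le> n"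
    then have "real (t + 2) \<le> real (2 * q)" by simp
    then have "t + 2 \<le> 2 * q" by (simp only: of_nat_le_iff)
    from ramsey_r_star_eq[OF this _ n assms(2)] q
    show "int (ramsey_r (complete_bipartite n n) (complete_bipartite 1 t) q) = int n - int t + int q"
      by linarith
  qed
  show "s \<le> t \<and> 2 \<le> s \<and> int q = int s * int t - int s - int t + 3 \<longrightarrow>
        (\<lambda>n::nat. real (ramsey_r (complete_bipartite n n) (complete_bipartite s t) q))
          \<in> \<Theta>(\<lambda>n. real n) \<and>
        (\<lambda>n::nat. real (ramsey_r (complete_bipartite n n) (complete_bipartite s t) (q - 1)))
          \<in> O(\<lambda>n. real n powr (1 - 1 / (real s + real t - 1)))"
  proof (intro impI conjI)
    assume asm: "s \<le> t \<and> 2 \<le> s \<and> int q = int s * int t - int s - int t + 3"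
    then have st: "s \<le> t" "2 \<le> s" by simp_all
    have "int (q + s + t) = int (s * t + 3)" using asm by simp
    then have q: "q + s + t = s * t + 3" by (simp only: of_nat_eq_iff)
    let ?r = "\<lambda>q n. real (ramsey_r (complete_bipartite n n) (complete_bipartite s t) q)"
    \<comment> \<open>Here \<open>d = s + t - 2\<close>, the largest value with
      \<open>q + d \<le> s * t + 1\<close>; the exponent becomes 1.\<close>
    have "?r q \<in> O(\<lambda>n. real n powr (real (s + t - 2) / real (s + t - 2)))"
      using st q by (intro ramsey_r_complete_bipartite_bigo) auto
    then have upper: "?r q \<in> O(\<lambda>n. real n)"
      using st by simp
    obtain s' t' where "s = Suc s'" "t = Suc t'"
      using assms gr0_implies_Suc by blast
    then have q': "q = (s - 1) * (t - 1) + 2" using q by simp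
    have "q \<le> s * t" using q st by linarith
    have "real n \<le> 2 * real t * ?r q n" for n
    proof (cases "n = 0")
      case False
      then have "n \<le> 2 * ramsey_r (complete_bipartite n n) (complete_bipartite s t) q * t"
            (is "_ \<le> ?m")
        using ramsey_r_complete_bipartite_linear[OF _ _ _ q' \<open>q \<le> s * t\<close>] assms st by blast
      then have "real n \<le> real ?m" by (simp only: of_nat_le_iff)
      then show ?thesis by (simp add: mult_ac)
    qed simp
    then have "(\<lambda>n. real n) \<in> O(?r q)"
      by (intro bigoI[of _ "2 * real t"]) (auto simp: mult_ac)
    with upper show "?r q \<in> \<Theta>(\<lambda>n. real n)"
      by (auto simp: bigtheta_def bigomega_iff_bigo)
    \<comment> \<open>Lowering \<open>q\<close> by one leaves room for
      \<open>d = s + t - 1\<close>.\<close>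
    have "?r (q - 1) \<in> O(\<lambda>n. real n powr (real (s + t - 2) / real (s + t - 1)))"
      using st q assms(3)
      by (intro ramsey_r_complete_bipartite_bigo) linarith+
    moreover have "real (s + t - 2) / real (s + t - 1) = 1 - 1 / (real s + real t - 1)"
    proof -
      have "real (s + t - 2) = real s + real t - 2" "real (s + t - 1) = real s + real t - 1"
        "real s + real t - 1 \<noteq> 0"
        using st by linarith+
      then show ?thesis by (simp add: field_simps)
    qed
    ultimately show "?r (q - 1) \<in> O(\<lambda>n. real n powr (1 - 1 / (real s + real t - 1)))"
      by simp
  qed
qed

end
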